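(* Every quasi adequate ring is an elementary divisor ring.
   Context: All rings are commutative with identity. $\mathbb{N}$ denotes the positive integers. A (not necessarily square) matrix $A$ over $R$ admits a diagonal reduction if there exist invertible matrices $P,Q$ over $R$ such that $PAQ=(d_{ij})$ is a diagonal matrix (i.e. $d_{ij}=0$ for $i\ne j$) in which $d_{ii}$ is a divisor of $d_{(i+1)(i+1)}$ for each $i$. A ring $R$ is an elementary divisor ring if every matrix over $R$ admits a diagonal reduction. A ring $R$ is a Hermite ring if every $1\times 2$ matrix over $R$ admits a diagonal reduction. An element $a\in R$ is adequate to $b\in R$ if there exist $r,s\in R$ such that (1) $a=rs$; (2) $rR+bR=R$; (3) $s'R+bR\neq R$ for each non-invertible divisor $s'$ of $s$. An element $a\in R$ is $\pi$-adequate to $b\in R$ if there exists $n\in\mathbb{N}$ such that $a^n$ is adequate to $b$. A quasi adequate ring is a Hermite ring such that for any pair of nonzero elements, at least one of these elements is $\pi$-adequate to the other. *)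

theory Defs
  imports "Jordan_Normal_Form.Matrix"
begin

text \<open>
  Rings are types of class \<^class>\<open>comm_ring_1\<close>; a property of a ring is a predicate on
  \<open>'a itself\<close>, to be used as \<open>P TYPE('a)\<close>. Matrix multiplication on \<^typ>\<open>'a mat\<close> is total,
  so the dimensions of \<open>P\<close> and \<open>Q\<close> have to be stated.
\<close>

definition admits_diagonal_reduction :: "'a::comm_ring_1 mat \<Rightarrow> bool" where
  "admits_diagonal_reduction A \<longleftrightarrow>
    (\<exists>P Q. P \<in> carrier_mat (dim_row A) (dim_row A) \<and> invertible_mat P \<and>
           Q \<in> carrier_mat (dim_col A) (dim_col A) \<and> invertible_mat Q \<and>
           diagonal_mat (P * A * Q) \<and>
           (\<forall>i. Suc i < min (dim_row A) (dim_col A) \<longrightarrow>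
                (P * A * Q) $$ (i, i) dvd (P * A * Q) $$ (Suc i, Suc i)))"

definition elementary_divisor_ring :: "'a::comm_ring_1 itself \<Rightarrow> bool" where
  "elementary_divisor_ring _ \<longleftrightarrow> (\<forall>A :: 'a mat. admits_diagonal_reduction A)"

definition Hermite_ring :: "'a::comm_ring_1 itself \<Rightarrow> bool" where
  "Hermite_ring _ \<longleftrightarrow> (\<forall>A \<in> carrier_mat 1 2. admits_diagonal_reduction (A :: 'a mat))"

text \<open>
  \<open>comaximal a b\<close> is \<open>aR + bR = R\<close>. The library's \<^const>\<open>coprime\<close> only says that common
  divisors are units, which is weaker in a general commutative ring.
\<close>

definition comaximal :: "'a::comm_ring_1 \<Rightarrow> 'a \<Rightarrow> bool" where
  "comaximal a b \<longleftrightarrow> {a * x + b * y | x y. True} = UNIV"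

definition adequate_to :: "'a::comm_ring_1 \<Rightarrow> 'a \<Rightarrow> bool" where
  "adequate_to a b \<longleftrightarrow>
    (\<exists>r s. a = r * s \<and> comaximal r b \<and>
           (\<forall>s'. s' dvd s \<and> \<not> s' dvd 1 \<longrightarrow> \<not> comaximal s' b))"

definition pi_adequate_to :: "'a::comm_ring_1 \<Rightarrow> 'a \<Rightarrow> bool" where
  "pi_adequate_to a b \<longleftrightarrow> (\<exists>n\<ge>1. adequate_to (a ^ n) b)"

definition quasi_adequate_ring :: "'a::comm_ring_1 itself \<Rightarrow> bool" where
  "quasi_adequate_ring _ \<longleftrightarrow>
    Hermite_ring TYPE('a) \<and>
    (\<forall>a b :: 'a. a \<noteq> 0 \<and> b \<noteq> 0 \<longrightarrow> pi_adequate_to a b \<or> pi_adequate_to b a)"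

end

theory Submission
  imports Defs
begin

text \<open>
  Let \<open>R\<close> be a quasi adequate ring. By a theorem of Kaplansky, a Hermite ring is an elementary
  divisor ring as soon as for all \<open>a, b, c\<close> generating the unit ideal there are \<open>p, q\<close> such that
  \<open>p a\<close> and \<open>p b + q c\<close> are comaximal. That is, \<open>1\<close> is a value of the bilinear form given by the
  triangular matrix with rows \<open>(a, 0)\<close> and \<open>(b, c)\<close>.

  The condition comes from applying the hypothesis to the two diagonal entries \<open>a\<close> and \<open>c\<close>
  (\<open>pi_adequate_to_shift\<close>). Suppose \<open>a ^ n = r s\<close> shows that \<open>a\<close> is \<open>\<pi>\<close>-adequate to \<open>c\<close>. Heuristically,
  the primes containing \<open>a\<close> split into those containing \<open>r\<close>, which avoid \<open>c\<close>, and those containing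
  \<open>s\<close>, which contain \<open>c\<close> and therefore avoid \<open>b\<close>. The first can be dealt with by moving \<open>b\<close>
  by a multiple of \<open>c\<close>, and the second need nothing; since \<open>r\<close> and \<open>s\<close> are comaximal, the Chinese
  remainder theorem does both at once and gives \<open>t\<close> with \<open>a\<close> and \<open>b + c t\<close> comaximal. Kaplansky's
  condition is symmetric in \<open>a\<close> and \<open>c\<close>, so the case where \<open>c\<close> is \<open>\<pi>\<close>-adequate to \<open>a\<close> follows.

  For Kaplansky's theorem, write a nonzero-sized matrix as \<open>g A\<close> where the entries of \<open>A\<close>
  generate the unit ideal. Induction on the rows, with the condition as the two-row case, gives
  vectors \<open>p, w\<close> with \<open>p A w = 1\<close> (\<open>matrix_represents_one\<close>). Both vectors are unimodular, so over
  a Hermite ring they are columns of invertible matrices (\<open>unimodular_column\<close>). Hence \<open>A\<close> is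
  equivalent to a matrix with corner entry \<open>1\<close>; this entry clears its row and column, and one
  recurses on the remaining block. The corner divides everything, which is why the divisibility
  chain needs no attention.
\<close>

section \<open>Invertible matrices\<close>

lemma invertible_matI:
  assumes "A \<in> carrier_mat n n" "B \<in> carrier_mat n n" "A * B = 1\<^sub>m n" "B * A = 1\<^sub>m n"
  shows "invertible_mat A"
  unfolding invertible_mat_def inverts_mat_def
  using assms by (intro conjI exI[of _ B]) auto

lemma invertible_matE:
  assumes "A \<in> carrier_mat n n" "invertible_mat A"
  obtains B where "B \<in> carrier_mat n n" "A * B = 1\<^sub>m n" "B * A = 1\<^sub>m n"
proof -
  obtain B where B: "A * B = 1\<^sub>m n" "B * A = 1\<^sub>m (dim_row B)"
    using assms unfolding invertible_mat_def inverts_mat_def by (metis carrier_matD(1))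
  have "dim_col B = n" using arg_cong[OF B(1), of dim_col] by simp
  moreover have row: "dim_row B = n" using arg_cong[OF B(2), of dim_col] assms by simp
  ultimately have "B \<in> carrier_mat n n" by (intro carrier_matI)
  then show thesis using that B unfolding row by blast
qed

lemma invertible_mat_mult:
  assumes A: "A \<in> carrier_mat n n" "invertible_mat A"
    and B: "B \<in> carrier_mat n n" "invertible_mat B"
  shows "invertible_mat (A * B)"
proof -
  obtain A' where A': "A' \<in> carrier_mat n n" "A * A' = 1\<^sub>m n" "A' * A = 1\<^sub>m n"
    using invertible_matE[OF A] by metis
  obtain B' where B': "B' \<in> carrier_mat n n" "B * B' = 1\<^sub>m n" "B' * B = 1\<^sub>m n"
    using invertible_matE[OF B] by metis
  have "A * B * (B' * A') = A * (B * B') * A'"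
    using A(1) B(1) A'(1) B'(1) by (simp add: assoc_mult_mat[of _ n n _ n _ n])
  moreover have "B' * A' * (A * B) = B' * (A' * A) * B"
    using A(1) B(1) A'(1) B'(1) by (simp add: assoc_mult_mat[of _ n n _ n _ n])
  ultimately show ?thesis
    using A B A' B' by (intro invertible_matI[of _ n "B' * A'"]) auto
qed

lemma invertible_mat_transpose:
  fixes A :: "'a::comm_ring_1 mat"
  assumes A: "A \<in> carrier_mat n n" "invertible_mat A"
  shows "invertible_mat A\<^sup>T"
proof -
  obtain B where B: "B \<in> carrier_mat n n" "A * B = 1\<^sub>m n" "B * A = 1\<^sub>m n"
    using invertible_matE[OF A] by metis
  have "A\<^sup>T * B\<^sup>T = 1\<^sub>m n"
    unfolding transpose_mult[OF B(1) A(1), symmetric] B(3) by simp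
  moreover have "B\<^sup>T * A\<^sup>T = 1\<^sub>m n"
    unfolding transpose_mult[OF A(1) B(1), symmetric] B(2) by simp
  ultimately show ?thesis
    using A(1) B(1) by (intro invertible_matI[of _ n "B\<^sup>T"]) simp_all
qed

abbreviation block_diag :: "'a::comm_ring_1 mat \<Rightarrow> 'a mat \<Rightarrow> 'a mat" where
  "block_diag A B \<equiv> four_block_mat A (0\<^sub>m (dim_row A) (dim_col B)) (0\<^sub>m (dim_row B) (dim_col A)) B"

lemma block_diag_mult:
  assumes "A \<in> carrier_mat k l" "B \<in> carrier_mat m n" "C \<in> carrier_mat l k'" "D \<in> carrier_mat n m'"
  shows "block_diag A B * block_diag C D = block_diag (A * C) (B * D)"
  using assms by (subst mult_four_block_mat[of _ k l _ n _ m _ _ k' _ m']) auto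

lemma invertible_block_diag:
  assumes A: "A \<in> carrier_mat m m" "invertible_mat A"
    and B: "B \<in> carrier_mat n n" "invertible_mat B"
  shows "invertible_mat (block_diag A B)"
proof -
  obtain A' where A': "A' \<in> carrier_mat m m" "A * A' = 1\<^sub>m m" "A' * A = 1\<^sub>m m"
    using invertible_matE[OF A] by metis
  obtain B' where B': "B' \<in> carrier_mat n n" "B * B' = 1\<^sub>m n" "B' * B = 1\<^sub>m n"
    using invertible_matE[OF B] by metis
  have "block_diag A B * block_diag A' B' = 1\<^sub>m (m + n)"
    using A(1) B(1) A' B' by (subst block_diag_mult[of _ m m _ n n]) auto
  moreover have "block_diag A' B' * block_diag A B = 1\<^sub>m (m + n)"
    using A(1) B(1) A' B' by (subst block_diag_mult[of _ m m _ n n]) auto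
  moreover have "block_diag A B \<in> carrier_mat (m + n) (m + n)"
    "block_diag A' B' \<in> carrier_mat (m + n) (m + n)"
    using A(1) B(1) A' B' by auto
  ultimately show ?thesis by (intro invertible_matI)
qed

lemma invertible_one_mat: "invertible_mat (1\<^sub>m n)"
  by (rule invertible_matI[of _ n "1\<^sub>m n"]) auto

section \<open>Comaximality and greatest common divisors\<close>

lemma comaximal_iff: "comaximal a b \<longleftrightarrow> (\<exists>x y. a * x + b * y = 1)"
proof
  assume "comaximal a b"
  then have "1 \<in> {a * x + b * y | x y. True}"
    unfolding comaximal_def by blast
  then show "\<exists>x y. a * x + b * y = 1" by auto
next
  assume "\<exists>x y. a * x + b * y = 1"
  then obtain x y where xy: "a * x + b * y = 1" by blast
  have "z = a * (x * z) + b * (y * z)" for z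
    using arg_cong[OF xy, of "\<lambda>w. w * z"] by (simp add: algebra_simps)
  then show "comaximal a b"
    unfolding comaximal_def by blast
qed

lemma comaximalI: "a * x + b * y = 1 \<Longrightarrow> comaximal a b"
  by (auto simp: comaximal_iff)

lemma comaximal_sym: "comaximal a b \<Longrightarrow> comaximal b a"
  by (metis comaximal_iff add.commute)

lemma comaximal_dvd: "comaximal a b \<Longrightarrow> a' dvd a \<Longrightarrow> comaximal a' b"
  by (metis comaximal_iff dvdE mult.assoc)

lemma comaximal_mult:
  assumes "comaximal a c" "comaximal b c"
  shows "comaximal (a * b) c"
proof -
  obtain x y x' y' where 1: "a * x + c * y = 1" and 2: "b * x' + c * y' = 1"
    using assms by (auto simp: comaximal_iff)
  have "a * b * (x * x') + c * (a * x * y' + y) = a * x * (b * x' + c * y') + c * y"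
    by (simp add: algebra_simps)
  also have "\<dots> = 1"
    using 1 2 by simp
  finally show ?thesis by (rule comaximalI)
qed

lemma comaximal_power: "comaximal a c \<Longrightarrow> comaximal (a ^ n) c"
proof (induction n)
  case 0
  show ?case by (rule comaximalI[of _ 1 _ 0]) simp
qed (simp add: comaximal_mult)

text \<open>
  If \<open>P (a b) Q = (d 0)\<close>, then \<open>(a b)\<close> is a multiple of the first row of the inverse of \<open>Q\<close>, and
  that row is unimodular. Zero divisors make this stronger than the existence of a gcd: cofactors
  of an arbitrary generator of \<open>aR + bR\<close> may fail to be comaximal.
\<close>

lemma Hermite_pair:
  fixes a b :: "'a::comm_ring_1"
  assumes "Hermite_ring TYPE('a)"
  obtains d u v s t where "a = d * u" "b = d * v" "u * s + v * t = 1"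
proof -
  define A where "A = mat 1 2 (\<lambda>(i, j). if j = 0 then a else b)"
  have A: "A \<in> carrier_mat 1 2" by (simp add: A_def)
  then have "admits_diagonal_reduction A"
    using assms by (simp add: Hermite_ring_def)
  then obtain P Q where P: "P \<in> carrier_mat 1 1" "invertible_mat P"
    and Q: "Q \<in> carrier_mat 2 2" "invertible_mat Q" and diag: "diagonal_mat (P * A * Q)"
    using A unfolding admits_diagonal_reduction_def by auto
  obtain P' where P'c: "P' \<in> carrier_mat 1 1" and P': "P' * P = 1\<^sub>m 1"
    using invertible_matE[OF P] by metis
  obtain Q' where Q'c: "Q' \<in> carrier_mat 2 2" and Q': "Q * Q' = 1\<^sub>m 2" "Q' * Q = 1\<^sub>m 2"
    using invertible_matE[OF Q] by metis
  define D where "D = P * A * Q"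
  have D: "D \<in> carrier_mat 1 2" using P Q A by (simp add: D_def)
  have "P' * D * Q' = A"
  proof -
    have "P' * D * Q' = (P' * P) * (A * (Q * Q'))"
      using P Q A P'c Q'c unfolding D_def
      by (simp add: assoc_mult_mat[of _ 1 1 _ 2 _ 2] assoc_mult_mat[of _ 1 1 _ 1 _ 2]
          assoc_mult_mat[of _ 1 2 _ 2 _ 2])
    also have "\<dots> = A"
      using P' Q' A by simp
    finally show ?thesis .
  qed
  moreover have D01: "D $$ (0, 1) = 0"
    using diag D unfolding diagonal_mat_def D_def[symmetric] by auto
  moreover define PD where "PD = P' * D"
  moreover have PD: "PD \<in> carrier_mat 1 2" using P'c D by (simp add: PD_def)
  moreover have "PD $$ (0, j) = P' $$ (0, 0) * D $$ (0, j)" if "j < 2" for j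
    using that P'c D by (simp add: PD_def scalar_prod_def)
  moreover have "(PD * Q') $$ (0, j) = PD $$ (0, 0) * Q' $$ (0, j) + PD $$ (0, 1) * Q' $$ (1, j)"
    if "j < 2" for j
    using that PD Q'c by (simp add: scalar_prod_def numeral_2_eq_2)
  ultimately have entry: "A $$ (0, j) = P' $$ (0, 0) * D $$ (0, 0) * Q' $$ (0, j)" if "j < 2" for j
    using that by simp
  have "(Q' * Q) $$ (0, 0) = 1"
    using Q' by simp
  then have "Q' $$ (0, 0) * Q $$ (0, 0) + Q' $$ (0, 1) * Q $$ (1, 0) = 1"
    using Q Q'c by (auto simp: scalar_prod_def numeral_2_eq_2)
  then show thesis
    using entry[of 0] entry[of 1]
    by (intro that[of "P' $$ (0, 0) * D $$ (0, 0)" "Q' $$ (0, 0)" "Q' $$ (0, 1)"])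
       (auto simp: A_def)
qed

lemma Hermite_gcd:
  fixes a b :: "'a::comm_ring_1"
  assumes "Hermite_ring TYPE('a)"
  obtains d x y where "d = a * x + b * y" "d dvd a" "d dvd b"
proof -
  obtain d u v s t where *: "a = d * u" "b = d * v" "u * s + v * t = 1"
    using Hermite_pair[OF assms] by metis
  have "a * s + b * t = d * (u * s + v * t)"
    using *(1,2) by (simp add: algebra_simps)
  then show thesis using * that[of d s t] by simp
qed

text \<open>
  The entries \<open>u\<close> are unimodular, which is what lets a common factor be split off a vector or
  a matrix. A nonempty index set is essential, as an empty family is never unimodular.
\<close>

lemma Hermite_family:
  fixes x :: "'i \<Rightarrow> 'a::comm_ring_1"
  assumes H: "Hermite_ring TYPE('a)" and "finite I" "I \<noteq> {}"
  shows "\<exists>d u w. (\<forall>i\<in>I. x i = d * u i) \<and> (\<Sum>i\<in>I. u i * w i) = 1"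
  using assms(2,3)
proof (induction rule: finite_ne_induct)
  case (singleton i)
  show ?case by (intro exI[of _ "x i"] exI[of _ "\<lambda>_. 1"]) auto
next
  case (insert k F)
  then obtain d u w where d: "\<forall>i\<in>F. x i = d * u i" and w: "(\<Sum>i\<in>F. u i * w i) = 1"
    by blast
  obtain g p q s t where g: "d = g * p" "x k = g * q" "p * s + q * t = 1"
    using Hermite_pair[OF H] by metis
  define u' where "u' = (\<lambda>i. if i = k then q else p * u i)"
  define w' where "w' = (\<lambda>i. if i = k then t else s * w i)"
  have "(\<Sum>i\<in>F. u' i * w' i) = (\<Sum>i\<in>F. (p * s) * (u i * w i))"
    using insert by (intro sum.cong) (auto simp: u'_def w'_def algebra_simps)
  also have "\<dots> = p * s"
    using w by (simp flip: sum_distrib_left)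
  finally have "(\<Sum>i\<in>insert k F. u' i * w' i) = 1"
    using insert g by (simp add: u'_def w'_def algebra_simps)
  moreover have "\<forall>i\<in>insert k F. x i = g * u' i"
    using insert d g by (auto simp: u'_def algebra_simps)
  ultimately show ?case by blast
qed

section \<open>Quasi adequate rings satisfy Kaplansky's condition\<close>

definition Kaplansky_condition :: "'a::comm_ring_1 itself \<Rightarrow> bool" where
  "Kaplansky_condition _ \<longleftrightarrow>
    (\<forall>a b c :: 'a. (\<exists>x y z. a * x + b * y + c * z = 1) \<longrightarrow>
       (\<exists>p q. comaximal (p * a) (p * b + q * c)))"

text \<open>
  The Chinese remainder argument described at the beginning. Common divisors stand in for primes:
  a divisor of \<open>s\<close> that is comaximal with \<open>c\<close> is a unit by adequacy, so \<open>s\<close> is comaximal with any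
  \<open>e\<close> whose common divisors with \<open>s\<close> are all comaximal with \<open>c\<close>. This applies to \<open>b\<close>,
  because \<open>a ^ n\<close>, \<open>b\<close>, \<open>c\<close> generate the unit ideal, and to \<open>r\<close>, because \<open>r\<close> is comaximal with \<open>c\<close>.
\<close>

lemma pi_adequate_to_shift:
  fixes a b c :: "'a::comm_ring_1"
  assumes H: "Hermite_ring TYPE('a)"
    and "pi_adequate_to a c"
    and unimodular: "a * x + b * y + c * z = 1"
  shows "\<exists>t. comaximal a (b + c * t)"
proof -
  obtain n r s where n: "n \<ge> 1" and rs: "a ^ n = r * s" and rc: "comaximal r c"
    and s: "\<And>s'. s' dvd s \<Longrightarrow> comaximal s' c \<Longrightarrow> s' dvd 1"
    using assms(2) unfolding pi_adequate_to_def adequate_to_def by blast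
  have s_comaximal: "comaximal s e"
    if "\<And>f. f dvd s \<Longrightarrow> f dvd e \<Longrightarrow> comaximal f c" for e
  proof -
    obtain f x y where f: "f = s * x + e * y" "f dvd s" "f dvd e"
      using Hermite_gcd[OF H] by metis
    then have "f dvd 1" using that[of f] s[of f] by simp
    then obtain g where "1 = f * g" by (rule dvdE)
    moreover have "s * (x * g) + e * (y * g) = f * g"
      unfolding f(1) by (simp add: algebra_simps)
    ultimately have "s * (x * g) + e * (y * g) = 1" by simp
    then show ?thesis by (rule comaximalI)
  qed
  have sb: "comaximal s b"
  proof (rule s_comaximal)
    fix f assume f: "f dvd s" "f dvd b"
    obtain d \<beta> \<gamma> where d: "d = b * \<beta> + c * \<gamma>" "d dvd b" "d dvd c"
      using Hermite_gcd[OF H] by metis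
    obtain b' where b': "b = d * b'" using d(2) by (rule dvdE)
    obtain c' where c': "c = d * c'" using d(3) by (rule dvdE)
    have "a * x + d * (b' * y + c' * z) = 1"
      using unimodular unfolding b' c' by (simp add: algebra_simps)
    then have "comaximal (a ^ n) d"
      by (rule comaximal_power[OF comaximalI])
    then obtain k l where kl: "a ^ n * k + d * l = 1" by (auto simp: comaximal_iff)
    obtain f1 where f1: "s = f * f1" using f(1) by (rule dvdE)
    obtain f2 where f2: "b = f * f2" using f(2) by (rule dvdE)
    have "f * (r * f1 * k + f2 * \<beta> * l) + c * (\<gamma> * l) = r * (f * f1) * k + (f * f2 * \<beta> + c * \<gamma>) * l"
      by (simp add: algebra_simps)
    also have "\<dots> = 1"
      using kl unfolding rs d(1) f1[symmetric] f2[symmetric] by simp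
    finally have "f * (r * f1 * k + f2 * \<beta> * l) + c * (\<gamma> * l) = 1" .
    then show "comaximal f c" by (rule comaximalI)
  qed
  have sr: "comaximal s r"
    using rc by (intro s_comaximal) (rule comaximal_dvd)
  have "comaximal (c * s) r"
    using rc sr by (intro comaximal_mult comaximal_sym[of r c])
  then obtain w v where wv: "c * s * w + r * v = 1" by (auto simp: comaximal_iff)
  \<comment> \<open>Modulo \<open>r\<close> this \<open>t\<close> shifts \<open>b\<close> to \<open>1\<close>, and modulo \<open>s\<close> it does not move \<open>b\<close>.\<close>
  define t where "t = s * w * (1 - b)"
  have "r * (v * (1 - b)) + (b + c * t) * 1 = (c * s * w + r * v) * (1 - b) + b"
    by (simp add: t_def algebra_simps)
  also have "\<dots> = 1" using wv by simp
  finally have r: "comaximal r (b + c * t)" by (rule comaximalI)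
  obtain k l where kl: "s * k + b * l = 1" using sb by (auto simp: comaximal_iff)
  have "s * (k - c * w * (1 - b) * l) + (b + c * t) * l = s * k + b * l"
    by (simp add: t_def algebra_simps)
  then have "comaximal s (b + c * t)" using kl by (intro comaximalI) auto
  with r have "comaximal (a ^ n) (b + c * t)"
    unfolding rs by (rule comaximal_mult)
  moreover have "a dvd a ^ n" using n by (simp add: dvd_power)
  ultimately show ?thesis by (blast intro: comaximal_dvd)
qed

lemma quasi_adequate_ring_imp_Kaplansky_condition:
  assumes "quasi_adequate_ring TYPE('a::comm_ring_1)"
  shows "Kaplansky_condition TYPE('a)"
  unfolding Kaplansky_condition_def
proof (intro allI impI)
  fix a b c :: 'a
  assume "\<exists>x y z. a * x + b * y + c * z = 1"
  then obtain x y z where xyz: "a * x + b * y + c * z = 1" by blast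
  have H: "Hermite_ring TYPE('a)" using assms by (simp add: quasi_adequate_ring_def)
  consider "a = 0" | "c = 0" | "pi_adequate_to a c" | "pi_adequate_to c a"
    using assms unfolding quasi_adequate_ring_def by meson
  \<comment> \<open>Adequacy is assumed for nonzero pairs only, but a zero on the diagonal makes the condition easy.\<close>
  then show "\<exists>p q. comaximal (p * a) (p * b + q * c)"
  proof cases
    case 1
    then have "(y * a) * 0 + (y * b + z * c) * 1 = 1" using xyz by (simp add: algebra_simps)
    from comaximalI[OF this] show ?thesis by (intro exI)
  next
    case 2
    then have "(1 * a) * x + (1 * b + 0 * c) * y = 1" using xyz by simp
    from comaximalI[OF this] show ?thesis by (intro exI)
  next
    case 3
    then obtain t where "comaximal a (b + c * t)"
      using pi_adequate_to_shift[OF H _ xyz] by blast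
    then have "comaximal (1 * a) (1 * b + t * c)" by (simp add: mult.commute)
    then show ?thesis by (intro exI)
  next
    case 4
    have "c * z + b * y + a * x = 1" using xyz by (simp add: algebra_simps)
    then obtain t where "comaximal c (b + a * t)"
      using pi_adequate_to_shift[OF H 4] by blast
    then obtain k l where "c * k + (b + a * t) * l = 1" by (auto simp: comaximal_iff)
    then have "(l * a) * t + (l * b + k * c) * 1 = 1" by (simp add: algebra_simps)
    from comaximalI[OF this] show ?thesis by (intro exI)
  qed
qed

section \<open>Unimodular matrices represent one\<close>

text \<open>
  Column operations would bring the two rows to \<open>(a, 0, \<dots>)\<close> and \<open>(b, c, 0, \<dots>)\<close>, where Kaplansky's
  condition applies. Instead of changing the basis, it suffices to find column vectors \<open>\<alpha>\<close> and \<open>\<gamma>\<close>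
  on which \<open>x\<close> takes the values \<open>a, 0\<close> and \<open>y\<close> the values \<open>b, c\<close>, where \<open>a, b, c\<close> generate all entries.
\<close>

lemma two_rows_represent_one:
  fixes x y :: "'j \<Rightarrow> 'a::comm_ring_1"
  assumes H: "Hermite_ring TYPE('a)" and K: "Kaplansky_condition TYPE('a)"
    and J: "finite J" "J \<noteq> {}"
    and one: "(\<Sum>j\<in>J. x j * \<xi> j) + (\<Sum>j\<in>J. y j * \<eta> j) = 1"
  shows "\<exists>p q w. (\<Sum>j\<in>J. (p * x j + q * y j) * w j) = 1"
proof -
  define dot where "dot = (\<lambda>f g :: 'j \<Rightarrow> 'a. \<Sum>j\<in>J. f j * g j)"
  have dot_add: "dot (\<lambda>j. f j + g j) h = dot f h + dot g h"
    "dot f (\<lambda>j. g j + h j) = dot f g + dot f h"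
    "dot f (\<lambda>j. g j - h j) = dot f g - dot f h" for f g h
    by (simp_all add: dot_def algebra_simps sum.distrib sum_subtractf)
  have dot_scale: "dot (\<lambda>j. e * f j) g = e * dot f g" "dot f (\<lambda>j. e * g j) = e * dot f g"
    for e f g by (simp_all add: dot_def sum_distrib_left algebra_simps)
  have dot_cong: "dot f h = dot g h" if "\<forall>j\<in>J. f j = g j" for f g h
    using that by (simp add: dot_def)
  obtain a u \<alpha> where a: "\<forall>j\<in>J. x j = a * u j" and u\<alpha>: "dot u \<alpha> = 1"
    using Hermite_family[OF H J] unfolding dot_def by metis
  define b where "b = dot y \<alpha>"
  obtain c v \<beta> where c: "\<forall>j\<in>J. y j - b * u j = c * v j" and v\<beta>: "dot v \<beta> = 1"
    using Hermite_family[OF H J, of "\<lambda>j. y j - b * u j"] unfolding dot_def by metis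
  have y: "\<forall>j\<in>J. y j = b * u j + c * v j"
    using c by (simp add: algebra_simps)
  have cv\<alpha>: "c * dot v \<alpha> = 0"
  proof -
    have "b = b * dot u \<alpha> + c * dot v \<alpha>"
      unfolding b_def by (subst dot_cong[OF y]) (simp add: dot_add dot_scale b_def)
    then show ?thesis using u\<alpha> by simp
  qed
  \<comment> \<open>Correcting \<open>\<beta>\<close> by a multiple of \<open>\<alpha>\<close> makes it orthogonal to \<open>u\<close>; the value \<open>c\<close> of \<open>y\<close> survives
    because \<open>c\<close> annihilates \<open>dot v \<alpha>\<close>.\<close>
  define \<gamma> where "\<gamma> = (\<lambda>j. \<beta> j - dot u \<beta> * \<alpha> j)"
  have dot_\<gamma>: "dot f \<gamma> = dot f \<beta> - dot u \<beta> * dot f \<alpha>" for f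
    by (simp add: \<gamma>_def dot_add dot_scale)
  have x\<alpha>: "dot x \<alpha> = a" and x\<gamma>: "dot x \<gamma> = 0"
    using u\<alpha> by (simp_all add: dot_cong[OF a] dot_scale dot_\<gamma>)
  have "dot y \<gamma> = b * (dot u \<beta> - dot u \<beta> * dot u \<alpha>) + (c * dot v \<beta> - dot u \<beta> * (c * dot v \<alpha>))"
    by (simp add: dot_cong[OF y] dot_add dot_scale dot_\<gamma> algebra_simps)
  also have "\<dots> = c"
    using cv\<alpha> u\<alpha> v\<beta> by simp
  finally have y\<gamma>: "dot y \<gamma> = c" .
  have "a * dot u \<xi> + (b * dot u \<eta> + c * dot v \<eta>) = dot x \<xi> + dot y \<eta>"
    by (simp add: dot_cong[OF a] dot_cong[OF y] dot_add dot_scale)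
  also have "\<dots> = 1"
    using one by (simp add: dot_def)
  finally have "c * dot v \<eta> + b * dot u \<eta> + a * dot u \<xi> = 1"
    by (simp add: algebra_simps)
  then obtain q p where "comaximal (q * c) (q * b + p * a)"
    using K unfolding Kaplansky_condition_def by blast
  then obtain k l where kl: "q * c * k + (q * b + p * a) * l = 1"
    by (auto simp: comaximal_iff)
  have "dot (\<lambda>j. p * x j + q * y j) (\<lambda>j. l * \<alpha> j + k * \<gamma> j) = 1"
    using kl x\<alpha> x\<gamma> y\<gamma> by (simp add: dot_add dot_scale b_def algebra_simps)
  then show ?thesis unfolding dot_def by (intro exI)
qed

text \<open>
  Without the row \<open>k\<close> the entries need not be unimodular; splitting off a common factor \<open>h\<close> restores
  this, and the induction hypothesis combines these rows into a single row \<open>y\<close> on which \<open>w\<close> takes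
  the value \<open>h\<close>. Thus \<open>y\<close> generates the same ideal as all the rows it replaces, and two rows are left.
\<close>

lemma matrix_represents_one:
  fixes A B :: "'i \<Rightarrow> 'j \<Rightarrow> 'a::comm_ring_1"
  assumes H: "Hermite_ring TYPE('a)" and K: "Kaplansky_condition TYPE('a)"
    and J: "finite J" "J \<noteq> {}"
    and "finite I" "I \<noteq> {}" "(\<Sum>i\<in>I. \<Sum>j\<in>J. A i j * B i j) = 1"
  shows "\<exists>p w. (\<Sum>i\<in>I. \<Sum>j\<in>J. p i * A i j * w j) = 1"
  using assms(5-)
proof (induction arbitrary: A B rule: finite_ne_induct)
  case (singleton i)
  then show ?case by (intro exI[of _ "\<lambda>_. 1"] exI[of _ "B i"]) simp
next
  case (insert k F)
  obtain h U W where U: "\<forall>z\<in>F \<times> J. A (fst z) (snd z) = h * U z"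
    and W: "(\<Sum>z\<in>F \<times> J. U z * W z) = 1"
    using Hermite_family[OF H, of "F \<times> J" "\<lambda>z. A (fst z) (snd z)"] insert J by auto
  have "(\<Sum>i\<in>F. \<Sum>j\<in>J. U (i, j) * W (i, j)) = 1"
    using W by (simp add: sum.cartesian_product split_def)
  then obtain p w where pw: "(\<Sum>i\<in>F. \<Sum>j\<in>J. p i * U (i, j) * w j) = 1"
    using insert.IH[of "\<lambda>i j. U (i, j)" "\<lambda>i j. W (i, j)"] by blast
  define y where "y = (\<lambda>j. \<Sum>i\<in>F. p i * A i j)"
  define e where "e = (\<Sum>i\<in>F. \<Sum>j\<in>J. U (i, j) * B i j)"
  have F: "(\<Sum>i\<in>F. \<Sum>j\<in>J. A i j * B i j) = h * e"
    using U unfolding e_def sum_distrib_left by (intro sum.cong) (auto simp: algebra_simps)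
  have "(\<Sum>j\<in>J. y j * w j) = (\<Sum>i\<in>F. \<Sum>j\<in>J. p i * A i j * w j)"
    unfolding y_def sum_distrib_right by (rule sum.swap)
  also have "\<dots> = h * (\<Sum>i\<in>F. \<Sum>j\<in>J. p i * U (i, j) * w j)"
    using U unfolding sum_distrib_left by (intro sum.cong) (auto simp: algebra_simps)
  finally have yw: "(\<Sum>j\<in>J. y j * w j) = h" using pw by simp
  have "(\<Sum>j\<in>J. y j * (w j * e)) = (\<Sum>j\<in>J. y j * w j) * e"
    by (simp add: sum_distrib_right mult.assoc)
  then have "(\<Sum>j\<in>J. A k j * B k j) + (\<Sum>j\<in>J. y j * (w j * e)) = 1"
    using insert F yw by simp
  then obtain p' q' w' where p': "(\<Sum>j\<in>J. (p' * A k j + q' * y j) * w' j) = 1"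
    using two_rows_represent_one[OF H K J, of "A k" "B k" y "\<lambda>j. w j * e"] by blast
  define p'' where "p'' = (\<lambda>i. if i = k then p' else q' * p i)"
  have "(\<Sum>i\<in>insert k F. p'' i * A i j * w' j) = (p' * A k j + q' * y j) * w' j" for j
  proof -
    have "(\<Sum>i\<in>F. p'' i * A i j * w' j) = (\<Sum>i\<in>F. q' * (p i * A i j) * w' j)"
      using insert by (intro sum.cong) (auto simp: p''_def algebra_simps)
    also have "\<dots> = q' * y j * w' j"
      by (simp add: y_def sum_distrib_left sum_distrib_right)
    finally show ?thesis using insert by (simp add: p''_def algebra_simps)
  qed
  then have "(\<Sum>i\<in>insert k F. \<Sum>j\<in>J. p'' i * A i j * w' j) = 1"
    using p' by (subst sum.swap) simp
  then show ?case by blast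
qed

section \<open>Invertible matrices with a prescribed first column\<close>

text \<open>
  Write the tail of \<open>u\<close> as \<open>d u'\<close> with \<open>u'\<close> unimodular. The induction hypothesis completes \<open>u'\<close> to an
  invertible matrix, which sends \<open>(u 0, d, 0, \<dots>)\<close> to \<open>u\<close>; and \<open>(u 0, d)\<close> is the first column of a
  \<open>2 \<times> 2\<close> matrix of determinant \<open>1\<close>.
\<close>

lemma unimodular_column:
  fixes u :: "nat \<Rightarrow> 'a::comm_ring_1"
  assumes H: "Hermite_ring TYPE('a)" and "(\<Sum>i<n. u i * w i) = 1"
  shows "\<exists>P \<in> carrier_mat n n. invertible_mat P \<and> (\<forall>i<n. P $$ (i, 0) = u i)"
  using assms(2)
proof (induction n arbitrary: u w)
  case 0
  then show ?case by simp
next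
  case (Suc n)
  show ?case
  proof (cases n)
    case 0
    then have "mat 1 1 (\<lambda>_. u 0) * mat 1 1 (\<lambda>_. w 0) = 1\<^sub>m 1"
      "mat 1 1 (\<lambda>_. w 0) * mat 1 1 (\<lambda>_. u 0) = 1\<^sub>m 1"
      using Suc.prems by (auto intro!: eq_matI simp: scalar_prod_def mult.commute)
    then have "invertible_mat (mat 1 1 (\<lambda>_. u 0))"
      by (intro invertible_matI[of _ 1]) auto
    then show ?thesis
      using 0 by (intro bexI[of _ "mat 1 1 (\<lambda>_. u 0)"]) auto
  next
    case (Suc k)
    have "{..<n} \<noteq> {}" using Suc by auto
    from Hermite_family[OF H finite_lessThan this, of "\<lambda>i. u (Suc i)"]
    obtain d u' w' where d: "\<forall>i\<in>{..<n}. u (Suc i) = d * u' i"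
      and u': "(\<Sum>i<n. u' i * w' i) = 1"
      by blast
    obtain P' where P': "P' \<in> carrier_mat n n" "invertible_mat P'" "\<forall>i<n. P' $$ (i, 0) = u' i"
      using Suc.IH[OF u'] by blast
    define \<beta> where "\<beta> = (\<Sum>i<n. u' i * w (Suc i))"
    have "d * \<beta> = (\<Sum>i<n. u (Suc i) * w (Suc i))"
      using d unfolding \<beta>_def sum_distrib_left by (intro sum.cong) (auto simp: mult.assoc)
    then have one: "u 0 * w 0 + d * \<beta> = 1"
      using Suc.prems by (simp only: sum.lessThan_Suc_shift)
    define G where "G = mat 2 2 (\<lambda>(i, j). if i = 0 then (if j = 0 then u 0 else - \<beta>)
      else (if j = 0 then d else w 0))"
    define G' where "G' = mat 2 2 (\<lambda>(i, j). if i = 0 then (if j = 0 then w 0 else \<beta>)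
      else (if j = 0 then - d else u 0))"
    have "G * G' = 1\<^sub>m 2" "G' * G = 1\<^sub>m 2"
      using one by (auto intro!: eq_matI
          simp: G_def G'_def scalar_prod_def numeral_2_eq_2 less_Suc_eq algebra_simps)
    then have G: "G \<in> carrier_mat 2 2" "invertible_mat G"
      by (auto intro!: invertible_matI[of _ 2 G'] simp: G_def G'_def)
    define L where "L = block_diag (1\<^sub>m 1) P'"
    define M where "M = block_diag G (1\<^sub>m k)"
    have L: "L \<in> carrier_mat (Suc n) (Suc n)" "invertible_mat L"
      using invertible_block_diag[OF one_carrier_mat invertible_one_mat P'(1,2), of 1] P'(1)
      by (auto simp: L_def)
    have M: "M \<in> carrier_mat (Suc n) (Suc n)" "invertible_mat M"
      using invertible_block_diag[OF G one_carrier_mat invertible_one_mat, of k] G(1) Suc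
      by (auto simp: M_def)
    have "(L * M) $$ (i, 0) = u i" if i: "i < Suc n" for i
    proof -
      have "(L * M) $$ (i, 0) = (\<Sum>l<Suc n. L $$ (i, l) * M $$ (l, 0))"
        using L(1) M(1) i by (simp add: scalar_prod_def lessThan_atLeast0)
      also have "\<dots> = L $$ (i, 0) * M $$ (0, 0) + L $$ (i, 1) * M $$ (1, 0)
          + (\<Sum>l<k. L $$ (i, Suc (Suc l)) * M $$ (Suc (Suc l), 0))"
        using Suc by (simp add: sum.lessThan_Suc_shift algebra_simps del: sum.lessThan_Suc)
      also have "(\<Sum>l<k. L $$ (i, Suc (Suc l)) * M $$ (Suc (Suc l), 0)) = 0"
        using G(1) by (intro sum.neutral) (auto simp: M_def)
      also have "M $$ (0, 0) = u 0" by (simp add: M_def G_def)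
      also have "M $$ (1, 0) = d" by (simp add: M_def G_def)
      also have "L $$ (i, 0) * u 0 + L $$ (i, 1) * d + 0 = u i"
        using i d P' Suc by (cases i) (auto simp: L_def mult.commute)
      finally show ?thesis .
    qed
    moreover have "L * M \<in> carrier_mat (Suc n) (Suc n)" "invertible_mat (L * M)"
      using L M invertible_mat_mult by auto
    ultimately show ?thesis by blast
  qed
qed

section \<open>Diagonal reduction of all matrices\<close>

lemma admits_diagonal_reduction_equivalent:
  assumes A: "A \<in> carrier_mat m n"
    and P: "P \<in> carrier_mat m m" "invertible_mat P"
    and Q: "Q \<in> carrier_mat n n" "invertible_mat Q"
    and red: "admits_diagonal_reduction (P * A * Q)"
  shows "admits_diagonal_reduction A"
proof -
  obtain P' Q' where P': "P' \<in> carrier_mat m m" "invertible_mat P'"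
    and Q': "Q' \<in> carrier_mat n n" "invertible_mat Q'"
    and D: "diagonal_mat (P' * (P * A * Q) * Q')"
      "\<forall>i. Suc i < min m n \<longrightarrow>
        (P' * (P * A * Q) * Q') $$ (i, i) dvd (P' * (P * A * Q) * Q') $$ (Suc i, Suc i)"
    using red A P Q unfolding admits_diagonal_reduction_def by auto
  have "P' * (P * A * Q) * Q' = (P' * P) * A * (Q * Q')"
    using P(1) Q(1) P'(1) Q'(1) A
    by (simp add: assoc_mult_mat[of _ m m _ m _ n] assoc_mult_mat[of _ m m _ n _ n]
        assoc_mult_mat[of _ m n _ n _ n] assoc_mult_mat[of _ m m _ m _ m])
  then show ?thesis
    using D A P Q P' Q' invertible_mat_mult[OF P' P] invertible_mat_mult[OF Q Q']
    unfolding admits_diagonal_reduction_def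
    by (intro exI[of _ "P' * P"] exI[of _ "Q * Q'"]) auto
qed

lemma admits_diagonal_reduction_smult:
  assumes "admits_diagonal_reduction A"
  shows "admits_diagonal_reduction (g \<cdot>\<^sub>m A)"
proof -
  obtain P Q where P: "P \<in> carrier_mat (dim_row A) (dim_row A)" "invertible_mat P"
    and Q: "Q \<in> carrier_mat (dim_col A) (dim_col A)" "invertible_mat Q"
    and D: "diagonal_mat (P * A * Q)"
      "\<forall>i. Suc i < min (dim_row A) (dim_col A) \<longrightarrow>
        (P * A * Q) $$ (i, i) dvd (P * A * Q) $$ (Suc i, Suc i)"
    using assms unfolding admits_diagonal_reduction_def by blast
  have A: "A \<in> carrier_mat (dim_row A) (dim_col A)" by simp
  define D where "D = P * A * Q"
  have dims: "dim_row D = dim_row A" "dim_col D = dim_col A"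
    using P(1) Q(1) by (simp_all add: D_def)
  have PgAQ: "P * (g \<cdot>\<^sub>m A) * Q = g \<cdot>\<^sub>m D"
    unfolding mult_smult_distrib[OF P(1) A]
      mult_smult_assoc_mat[OF mult_carrier_mat[OF P(1) A] Q(1)] D_def ..
  have "diagonal_mat (g \<cdot>\<^sub>m D)"
    using D(1) unfolding D_def[symmetric] by (simp add: diagonal_mat_def)
  moreover have "(g \<cdot>\<^sub>m D) $$ (i, i) dvd (g \<cdot>\<^sub>m D) $$ (Suc i, Suc i)"
    if "Suc i < min (dim_row A) (dim_col A)" for i
    using that D(2) dims unfolding D_def[symmetric] by (simp add: mult_dvd_mono)
  ultimately show ?thesis
    using P Q unfolding admits_diagonal_reduction_def index_smult_mat(2,3)
    by (intro exI[of _ P] exI[of _ Q]) (simp add: PgAQ)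
qed

lemma admits_diagonal_reduction_one_block:
  assumes C: "C \<in> carrier_mat m n" and "admits_diagonal_reduction C"
  shows "admits_diagonal_reduction (block_diag (1\<^sub>m 1) C)"
proof -
  obtain P Q where P: "P \<in> carrier_mat m m" "invertible_mat P"
    and Q: "Q \<in> carrier_mat n n" "invertible_mat Q"
    and D: "diagonal_mat (P * C * Q)"
      "\<forall>i. Suc i < min m n \<longrightarrow> (P * C * Q) $$ (i, i) dvd (P * C * Q) $$ (Suc i, Suc i)"
    using assms unfolding admits_diagonal_reduction_def by auto
  define E where "E = P * C * Q"
  have E: "E \<in> carrier_mat m n" using P Q C by (simp add: E_def)
  let ?P = "block_diag (1\<^sub>m 1) P" and ?Q = "block_diag (1\<^sub>m 1) Q"
  have "?P * block_diag (1\<^sub>m 1) C = block_diag (1\<^sub>m 1) (P * C)"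
    using P C by (subst block_diag_mult[of _ 1 1 _ m m _ 1 _ n]) auto
  moreover have "block_diag (1\<^sub>m 1) (P * C) * ?Q = block_diag (1\<^sub>m 1) E"
    using P C Q unfolding E_def by (subst block_diag_mult[of _ 1 1 _ m n _ 1 _ n]) auto
  ultimately have eq: "?P * block_diag (1\<^sub>m 1) C * ?Q = block_diag (1\<^sub>m 1) E" by simp
  have "diagonal_mat (block_diag (1\<^sub>m 1) E)"
    using D(1) E unfolding diagonal_mat_def E_def[symmetric] by auto
  moreover have "block_diag (1\<^sub>m 1) E $$ (i, i) dvd block_diag (1\<^sub>m 1) E $$ (Suc i, Suc i)"
    if "Suc i < min (Suc m) (Suc n)" for i
    using that D(2) E unfolding E_def[symmetric] by (cases i) auto
  moreover have "invertible_mat ?P" "invertible_mat ?Q"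
    using invertible_block_diag[OF one_carrier_mat invertible_one_mat P, of 1]
      invertible_block_diag[OF one_carrier_mat invertible_one_mat Q, of 1] by auto
  ultimately show ?thesis
    using P(1) Q(1) C eq unfolding admits_diagonal_reduction_def
    by (intro exI[of _ ?P] exI[of _ ?Q]) auto
qed

lemma clear_first_row_and_column:
  fixes E :: "'a::comm_ring_1 mat"
  assumes E: "E \<in> carrier_mat (Suc m) (Suc n)" and E00: "E $$ (0, 0) = 1"
  shows "\<exists>L R C. L \<in> carrier_mat (Suc m) (Suc m) \<and> invertible_mat L \<and>
    R \<in> carrier_mat (Suc n) (Suc n) \<and> invertible_mat R \<and>
    C \<in> carrier_mat m n \<and> L * E * R = block_diag (1\<^sub>m 1) C"
proof -
  obtain A1 A2 A3 A4 where split: "split_block E 1 1 = (A1, A2, A3, A4)"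
    by (metis prod_cases4)
  have dims: "dim_row E = 1 + m" "dim_col E = 1 + n" using E by auto
  note sb = split_block[OF split dims]
  have "A1 = 1\<^sub>m 1"
    using split E00 by (auto simp: split_block_def Let_def intro!: eq_matI)
  then have E_eq: "E = four_block_mat (1\<^sub>m 1) A2 A3 A4" using sb by simp
  define L where "L = (\<lambda>S. four_block_mat (1\<^sub>m 1) (0\<^sub>m 1 m) S (1\<^sub>m m) :: 'a mat)"
  define R where "R = (\<lambda>S. four_block_mat (1\<^sub>m 1) S (0\<^sub>m n 1) (1\<^sub>m n) :: 'a mat)"
  have LL: "L S * L T = L (S + T)" if "S \<in> carrier_mat m 1" "T \<in> carrier_mat m 1" for S T
    using that unfolding L_def by (subst mult_four_block_mat[of _ 1 1 _ m _ m _ _ 1 _ m]) auto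
  have RR: "R S * R T = R (T + S)" if "S \<in> carrier_mat 1 n" "T \<in> carrier_mat 1 n" for S T
    using that unfolding R_def by (subst mult_four_block_mat[of _ 1 1 _ n _ n _ _ 1 _ n]) auto
  have L0: "L (0\<^sub>m m 1) = 1\<^sub>m (Suc m)" and R0: "R (0\<^sub>m 1 n) = 1\<^sub>m (Suc n)"
    by (simp_all add: L_def R_def)
  have Lc: "L S \<in> carrier_mat (Suc m) (Suc m)" and Rc: "R S \<in> carrier_mat (Suc n) (Suc n)" for S
    by (simp_all add: L_def R_def carrier_matI)
  have nA3: "- A3 \<in> carrier_mat m 1" and nA2: "- A2 \<in> carrier_mat 1 n"
    using sb(2,3) by simp_all
  have "A3 + - A3 = 0\<^sub>m m 1" "A2 + - A2 = 0\<^sub>m 1 n"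
    using sb(2,3) by (auto intro!: eq_matI)
  then have L: "invertible_mat (L (- A3))" and R: "invertible_mat (R (- A2))"
    using LL[OF nA3 sb(3)] LL[OF sb(3) nA3] RR[OF nA2 sb(2)] RR[OF sb(2) nA2] L0 R0
    unfolding uminus_l_inv_mat[OF sb(3)] uminus_l_inv_mat[OF sb(2)]
    by (auto intro: invertible_matI[OF Lc Lc[of A3]] invertible_matI[OF Rc Rc[of A2]]
        simp del: One_nat_def)
  define C where "C = - A3 * A2 + A4"
  have C: "C \<in> carrier_mat m n" using sb by (simp add: C_def)
  have "L (- A3) * E = four_block_mat (1\<^sub>m 1) A2 (0\<^sub>m m 1) C"
    using sb(2,3,4) unfolding E_eq L_def C_def
    by (subst mult_four_block_mat[of _ 1 1 _ m _ m _ _ 1 _ n]) (auto simp: uminus_l_inv_mat)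
  also have "\<dots> * R (- A2) = block_diag (1\<^sub>m 1) C"
    using sb(2) C unfolding R_def
    by (subst mult_four_block_mat[of _ 1 1 _ n _ m _ _ 1 _ n]) (auto simp: uminus_l_inv_mat)
  finally show ?thesis using L R Lc Rc C by blast
qed

text \<open>
  The common factor \<open>g\<close> is put back only after the unimodular matrix \<open>A1\<close> has been reduced: with
  the corner \<open>1\<close> the row and column can be cleared, and \<open>1\<close> divides whatever diagonal the
  remaining block is reduced to. Multiplying by \<open>g\<close> preserves divisibility.
\<close>

theorem Kaplansky_condition_imp_elementary_divisor_ring:
  assumes H: "Hermite_ring TYPE('a::comm_ring_1)" and K: "Kaplansky_condition TYPE('a)"
  shows "elementary_divisor_ring TYPE('a)"
proof -
  have "admits_diagonal_reduction A" if "A \<in> carrier_mat m n" for A :: "'a mat" and m n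
    using that
  proof (induction m arbitrary: n A)
    case 0
    then show ?case
      unfolding admits_diagonal_reduction_def
      by (intro exI[of _ "1\<^sub>m 0"] exI[of _ "1\<^sub>m n"])
         (auto simp: diagonal_mat_def invertible_one_mat)
  next
    case (Suc m)
    show ?case
    proof (cases n)
      case 0
      with Suc.prems show ?thesis
        unfolding admits_diagonal_reduction_def
        by (intro exI[of _ "1\<^sub>m (Suc m)"] exI[of _ "1\<^sub>m 0"])
           (auto simp: diagonal_mat_def invertible_one_mat)
    next
      case (Suc n')
      have I: "finite ({..<Suc m} \<times> {..<n})" "{..<Suc m} \<times> {..<n} \<noteq> {}"
        using Suc by auto
      from Hermite_family[OF H I, of "\<lambda>z. A $$ z"]
      obtain g U W where U: "\<forall>z\<in>{..<Suc m} \<times> {..<n}. A $$ z = g * U z"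
        and W: "(\<Sum>z\<in>{..<Suc m} \<times> {..<n}. U z * W z) = 1"
        by blast
      define A1 where "A1 = mat (Suc m) n U"
      have A1: "A1 \<in> carrier_mat (Suc m) n" by (simp add: A1_def)
      have A: "A = g \<cdot>\<^sub>m A1"
        using Suc.prems U by (intro eq_matI) (auto simp: A1_def)
      have "(\<Sum>i<Suc m. \<Sum>j<n. U (i, j) * W (i, j)) = (\<Sum>z\<in>{..<Suc m} \<times> {..<n}. U z * W z)"
        unfolding sum.cartesian_product by (intro sum.cong) auto
      then have UW: "(\<Sum>i<Suc m. \<Sum>j<n. U (i, j) * W (i, j)) = 1"
        unfolding W .
      have "{..<n} \<noteq> {}" "{..<Suc m} \<noteq> {}" using Suc by auto
      from matrix_represents_one[OF H K finite_lessThan this(1) finite_lessThan this(2),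
          of "\<lambda>i j. U (i, j)" "\<lambda>i j. W (i, j)", OF UW]
      obtain p w where pw: "(\<Sum>i<Suc m. \<Sum>j<n. p i * U (i, j) * w j) = 1"
        by (elim exE)
      have "(\<Sum>i<Suc m. p i * (\<Sum>j<n. U (i, j) * w j)) = 1"
        using pw by (simp only: sum_distrib_left mult.assoc)
      from unimodular_column[OF H this] obtain P
        where P: "P \<in> carrier_mat (Suc m) (Suc m)" "invertible_mat P"
          "\<forall>i<Suc m. P $$ (i, 0) = p i"
        by blast
      have "(\<Sum>j<n. w j * (\<Sum>i<Suc m. p i * U (i, j))) =
          (\<Sum>j<n. \<Sum>i<Suc m. p i * U (i, j) * w j)"
        unfolding sum_distrib_left by (intro sum.cong refl) (rule mult.commute)
      also have "\<dots> = 1"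
        using pw by (subst sum.swap)
      finally have "(\<Sum>j<n. w j * (\<Sum>i<Suc m. p i * U (i, j))) = 1" .
      from unimodular_column[OF H this] obtain Q
        where Q: "Q \<in> carrier_mat n n" "invertible_mat Q" "\<forall>j<n. Q $$ (j, 0) = w j"
        by blast
      define E where "E = P\<^sup>T * (A1 * Q)"
      have E: "E \<in> carrier_mat (Suc m) (Suc n')"
        using P Q A1 Suc by (simp add: E_def)
      have A1Q: "(A1 * Q) $$ (i, 0) = (\<Sum>j<n. U (i, j) * w j)" if "i < Suc m" for i
        using that Q(1,3) Suc by (simp add: A1_def scalar_prod_def lessThan_atLeast0
            del: sum.lessThan_Suc sum.op_ivl_Suc)
      have "E $$ (0, 0) = (\<Sum>i<Suc m. P $$ (i, 0) * (A1 * Q) $$ (i, 0))"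
        unfolding E_def using P(1) Q(1) A1 Suc
        by (subst index_mult_mat(1)) (auto simp: scalar_prod_def lessThan_atLeast0
            simp del: sum.lessThan_Suc sum.op_ivl_Suc intro!: sum.cong)
      also have "\<dots> = (\<Sum>i<Suc m. p i * (\<Sum>j<n. U (i, j) * w j))"
        using P(3) A1Q by (intro sum.cong) auto
      finally have "E $$ (0, 0) = (\<Sum>i<Suc m. p i * (\<Sum>j<n. U (i, j) * w j))" .
      then have "E $$ (0, 0) = 1"
        using pw by (simp only: sum_distrib_left mult.assoc)
      then obtain L R C where L: "L \<in> carrier_mat (Suc m) (Suc m)" "invertible_mat L"
        and R: "R \<in> carrier_mat (Suc n') (Suc n')" "invertible_mat R"
        and C: "C \<in> carrier_mat m n'" and LER: "L * E * R = block_diag (1\<^sub>m 1) C"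
        using clear_first_row_and_column[OF E] by blast
      have "admits_diagonal_reduction E"
        using admits_diagonal_reduction_equivalent[OF E L R]
          admits_diagonal_reduction_one_block[OF C Suc.IH[OF C]] LER by simp
      moreover have "E = P\<^sup>T * A1 * Q"
        using P A1 Q unfolding E_def
        by (simp add: assoc_mult_mat[of _ "Suc m" "Suc m" _ n _ n])
      ultimately have "admits_diagonal_reduction A1"
        using admits_diagonal_reduction_equivalent[OF A1 _ invertible_mat_transpose[OF P(1,2)] Q(1,2)]
          P(1) by simp
      then show ?thesis
        unfolding A by (rule admits_diagonal_reduction_smult)
    qed
  qed
  then show ?thesis
    unfolding elementary_divisor_ring_def by blast
qed

theorem theorem4p8:
  assumes "quasi_adequate_ring TYPE('a::comm_ring_1)"
  shows "elementary_divisor_ring TYPE('a)"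
  using assms
  by (intro Kaplansky_condition_imp_elementary_divisor_ring
      quasi_adequate_ring_imp_Kaplansky_condition)
     (simp_all add: quasi_adequate_ring_def)

end
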